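(* (Local lifting property.) Let $A,C\in\Sigma_{\mathrm h}^{\mathrm{unc}}$ and $B,D\in\Sigma_{\mathrm v}^{\mathrm{unc}}$, and let $a\in\Sigma_{\mathrm h}^{\mathrm{col}}$, $b\in\Sigma_{\mathrm v}^{\mathrm{col}}$ be such that $p_{\mathrm h}(a)=A$ and $p_{\mathrm v}(b)=B$. Then $$\beta_R^{\mathrm{unc}}(A,B,C,D)=\sum_{\substack{(c,d)\in\Sigma_{\mathrm h}^{\mathrm{col}}\times\Sigma_{\mathrm v}^{\mathrm{col}}\\ p_{\mathrm h}(c)=C,\ p_{\mathrm v}(d)=D}}\beta_R^{\mathrm{col}}(a,b,c,d),$$ where both sides use the same spectral parameter $z$ and the same $t$.
   Context: Vertex weights are functions of the spins in the order (left, top, right, bottom). Fix $r\ge1$, colors $\gamma_1>\cdots>\gamma_r$, and parameters $z,t$. Spinsets. $\Sigma_{\mathrm h}^{\mathrm{unc}}=\{+,-\}$, $\Sigma_{\mathrm v}^{\mathrm{unc}}=\mathbb N=\{0,1,2,\dots\}$, $\Sigma_{\mathrm h}^{\mathrm{col}}=\{+,\gamma_1,\dots,\gamma_r\}$, and $\Sigma_{\mathrm v}^{\mathrm{col}}$ is the set of multisets $\gamma_1^{m_1}\cdots\gamma_r^{m_r}$, $m_k\in\mathbb N$. The map $p_{\mathrm h}:\Sigma_{\mathrm h}^{\mathrm{col}}\to\Sigma_{\mathrm h}^{\mathrm{unc}}$ sends $+\mapsto+$ and every color to $-$; $p_{\mathrm v}:\Sigma_{\mathrm v}^{\mathrm{col}}\to\Sigma_{\mathrm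 v}^{\mathrm{unc}}$ sends $\gamma_1^{m_1}\cdots\gamma_r^{m_r}\mapsto\sum_k m_k$. Uncolored $R$-weights $\beta_R^{\mathrm{unc}}$ (for $n\in\mathbb N$): $(+,n,+,n)$: $1$; $(-,n,-,n)$: $z$; $(-,n,+,n+1)$: $z(1-t)$; $(+,n+1,-,n)$: $\frac{1-t^{n+1}}{1-t}$; all others $0$. Colored $R$-weights $\beta_R^{\mathrm{col}}$. For a color $g$, the monochrome vertex of type $(z,g)$ has horizontal spins in $\Sigma_{\mathrm h}^{\mathrm{col}}$, vertical spins in $\mathbb N$, and $R$-weights, for $n\in\mathbb N$: $(+,n,+,n)$: $1$; $(h,n,h,n)$ for a color $h$: $1$ if $g<h$, $z$ if $g=h$, $t^n$ if $g>h$; $(g,n,+,n+1)$: $z(1-t)$; $(+,n+1,g,n)$: $\frac{1-t^{n+1}}{1-t}$; all others $0$. Then $\beta_R^{\mathrm{col}}(a,\gamma_1^{b_1}\cdots\gamma_r^{b_r},c,\gamma_1^{d_1}\cdots\gamma_r^{d_r})$ is the partition function of a row of monochrome vertices of types $(z,\gamma_r),(z,\gamma_{r-1}),\dots,(z,\gamma_1)$ from left to right, the one of color $\gamma_k$ having top spin $b_k$ and bottom spin $d_k$, with leftmost spin $a$ and rightmost spin $c$, summed over interior horizontal spins (at most one term is nonzero). *)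

theory Defs
  imports Complex_Main "HOL-Library.Multiset" "HOL-Library.FuncSet"
begin

text \<open>
  The colors are \<open>\<gamma> 1 > \<dots> > \<gamma> r\<close>, for a map \<open>\<gamma>\<close> into an arbitrary linear order that is strictly
  decreasing on \<open>{1..r}\<close>. All weights take the spins in the order left, top, right, bottom.
\<close>

datatype hspin_unc = UPlus | UMinus

datatype 'c hspin_col = CPlus | Color 'c

definition Sigma_h_col :: "(nat \<Rightarrow> 'c) \<Rightarrow> nat \<Rightarrow> 'c hspin_col set" where
  "Sigma_h_col \<gamma> r = insert CPlus (Color ` \<gamma> ` {1..r})"

definition Sigma_v_col :: "(nat \<Rightarrow> 'c) \<Rightarrow> nat \<Rightarrow> 'c multiset set" where
  "Sigma_v_col \<gamma> r = {m. set_mset m \<subseteq> \<gamma> ` {1..r}}"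

fun p_h :: "'c hspin_col \<Rightarrow> hspin_unc" where
  "p_h CPlus = UPlus"
| "p_h (Color g) = UMinus"

definition p_v :: "'c multiset \<Rightarrow> nat" where
  "p_v m = size m"

text \<open>
  The parameters \<open>z\<close> and \<open>t\<close> lie in an arbitrary field, for instance the complex numbers or a field
  of rational functions. The quotient \<open>(1 - t ^ (n + 1)) / (1 - t)\<close> is meaningful for \<open>t \<noteq> 1\<close>;
  at \<open>t = 1\<close> division by zero makes it \<open>0\<close>.
\<close>

fun beta_R_unc :: "'a::field \<Rightarrow> 'a \<Rightarrow> hspin_unc \<Rightarrow> nat \<Rightarrow> hspin_unc \<Rightarrow> nat \<Rightarrow> 'a" where
  "beta_R_unc z t UPlus n UPlus m = (if m = n then 1 else 0)"
| "beta_R_unc z t UMinus n UMinus m = (if m = n then z else 0)"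
| "beta_R_unc z t UMinus n UPlus m = (if m = n + 1 then z * (1 - t) else 0)"
| "beta_R_unc z t UPlus n UMinus m = (if n = m + 1 then (1 - t ^ (m + 1)) / (1 - t) else 0)"

text \<open>The monochrome vertex of type \<open>(z, g)\<close>.\<close>

fun mono_R :: "'a::field \<Rightarrow> 'a \<Rightarrow> 'c::linorder \<Rightarrow>
    'c hspin_col \<Rightarrow> nat \<Rightarrow> 'c hspin_col \<Rightarrow> nat \<Rightarrow> 'a" where
  "mono_R z t g CPlus n CPlus m = (if m = n then 1 else 0)"
| "mono_R z t g (Color h) n (Color h') m =
     (if h' = h \<and> m = n then (if g < h then 1 else if g = h then z else t ^ n) else 0)"
| "mono_R z t g (Color h) n CPlus m = (if h = g \<and> m = n + 1 then z * (1 - t) else 0)"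
| "mono_R z t g CPlus n (Color h) m =
     (if h = g \<and> n = m + 1 then (1 - t ^ (m + 1)) / (1 - t) else 0)"

text \<open>
  The partition function of the row of monochrome vertices of colors \<open>\<gamma> r, \<dots>, \<gamma> 1\<close> from left to
  right. A state \<open>s\<close> is indexed so that the vertex of color \<open>\<gamma> k\<close> has left spin \<open>s k\<close> and right spin
  \<open>s (k - 1)\<close>: thus \<open>s r\<close> is the leftmost spin of the row and \<open>s 0\<close> the rightmost one.
\<close>

definition row_states ::
    "(nat \<Rightarrow> 'c) \<Rightarrow> nat \<Rightarrow> 'c hspin_col \<Rightarrow> 'c hspin_col \<Rightarrow> (nat \<Rightarrow> 'c hspin_col) set" where
  "row_states \<gamma> r a c = {s \<in> {0..r} \<rightarrow>\<^sub>E Sigma_h_col \<gamma> r. s r = a \<and> s 0 = c}"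

definition beta_R_col :: "(nat \<Rightarrow> 'c::linorder) \<Rightarrow> nat \<Rightarrow> 'a::field \<Rightarrow> 'a \<Rightarrow>
    'c hspin_col \<Rightarrow> 'c multiset \<Rightarrow> 'c hspin_col \<Rightarrow> 'c multiset \<Rightarrow> 'a" where
  "beta_R_col \<gamma> r z t a b c d =
     (\<Sum>s\<in>row_states \<gamma> r a c.
        \<Prod>k=1..r. mono_R z t (\<gamma> k) (s k) (count b (\<gamma> k)) (s (k - 1)) (count d (\<gamma> k)))"

text \<open>
  Both index sets are finite, so that neither sum is affected by the convention that sums over
  infinite sets vanish.
\<close>

lemma finite_Sigma_h_col: "finite (Sigma_h_col \<gamma> r)"
  by (simp add: Sigma_h_col_def)

lemma finite_row_states: "finite (row_states \<gamma> r a c)"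
  unfolding row_states_def
  by (rule finite_subset[of _ "{0..r} \<rightarrow>\<^sub>E Sigma_h_col \<gamma> r"])
     (auto intro: finite_PiE finite_Sigma_h_col)

lemma finite_lifts:
  "finite {(c, d). c \<in> Sigma_h_col \<gamma> r \<and> d \<in> Sigma_v_col \<gamma> r \<and> p_h c = C \<and> p_v d = D}"
proof -
  let ?L = "{xs. set xs \<subseteq> \<gamma> ` {1..r} \<and> length xs = D}"
  have "d \<in> mset ` ?L" if "d \<in> Sigma_v_col \<gamma> r" "p_v d = D" for d
  proof -
    obtain xs where "mset xs = d" using ex_mset by blast
    with that show ?thesis by (auto simp: Sigma_v_col_def p_v_def)
  qed
  then have "{(c, d). c \<in> Sigma_h_col \<gamma> r \<and> d \<in> Sigma_v_col \<gamma> r \<and> p_h c = C \<and> p_v d = D}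
      \<subseteq> Sigma_h_col \<gamma> r \<times> mset ` ?L" by auto
  moreover have "finite ?L" by (rule finite_lists_length_eq) simp
  ultimately show ?thesis by (meson finite_SigmaI finite_Sigma_h_col finite_imageI finite_subset)
qed

end

theory Submission
  imports Defs
begin

text \<open>
  Reading the row from the right, let \<open>S k\<close> be the number of particles on top of the \<open>k\<close> rightmost
  columns. Summing the colored weights of these columns over all lifts gives the uncolored weight
  with top spin \<open>S k\<close> if the left spin is \<open>+\<close> or one of the colors \<open>\<gamma> 1, \<dots>, \<gamma> k\<close>; any other color
  traverses all the columns and contributes \<open>t ^ S k\<close>. This trichotomy is preserved when one more
  column is attached on the left, the identity behind it being
  \<open>(1 - t ^ m) * t ^ S + (1 - t ^ S) = 1 - t ^ (m + S)\<close>.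
\<close>

section \<open>Rows of vertices as ordered products of transfer matrices\<close>

primrec path_weight ::
    "(nat \<Rightarrow> 'x \<Rightarrow> 'x \<Rightarrow> 'a::comm_semiring_1) \<Rightarrow> 'x set \<Rightarrow> nat \<Rightarrow> 'x \<Rightarrow> 'x \<Rightarrow> 'a" where
  "path_weight w X 0 a c = (if a = c then 1 else 0)"
| "path_weight w X (Suc k) a c = (\<Sum>y\<in>X. w (Suc k) a y * path_weight w X k y c)"

lemma path_weight_cong:
  assumes "\<And>i x y. 1 \<le> i \<Longrightarrow> i \<le> k \<Longrightarrow> w i x y = w' i x y"
  shows "path_weight w X k a c = path_weight w' X k a c"
  using assms by (induction k arbitrary: a) (auto intro!: sum.cong)

text \<open>The interior spins of a row are the intermediate indices when the matrix product
  \<open>w k * ... * w 1\<close> is expanded. The induction peels off the leftmost factor, hence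
  \<open>a\<close> varies and \<open>c\<close> stays fixed.\<close>

lemma sum_paths_eq_path_weight:
  assumes "finite X" "a \<in> X"
  shows "(\<Sum>s\<in>{s \<in> {0..k} \<rightarrow>\<^sub>E X. s k = a \<and> s 0 = c}. \<Prod>i=1..k. w i (s i) (s (i - 1)))
    = path_weight w X k a c"
  using assms(2)
proof (induction k arbitrary: a)
  case 0
  have "{s \<in> {0..0::nat} \<rightarrow>\<^sub>E X. s 0 = a \<and> s 0 = c}
      = (if a = c then {(\<lambda>i. undefined)(0 := a)} else {})"
    using 0 by (auto simp: PiE_iff extensional_def fun_eq_iff)
  then show ?case by simp
next
  case (Suc k)
  let ?P = "\<lambda>k a. {s \<in> {0..k} \<rightarrow>\<^sub>E X. s k = a \<and> s 0 = c}"
  have fin: "finite (?P k y)" for y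
    by (rule finite_subset[of _ "{0..k} \<rightarrow>\<^sub>E X"]) (auto intro: finite_PiE assms(1))
  have "(\<Sum>s\<in>?P (Suc k) a. \<Prod>i=1..Suc k. w i (s i) (s (i - 1)))
      = (\<Sum>(y, s)\<in>Sigma X (?P k). w (Suc k) a y * (\<Prod>i=1..k. w i (s i) (s (i - 1))))"
  \<comment> \<open>Cutting off the leftmost vertex leaves a shorter row whose left spin is
    \<open>s k\<close>; restricting keeps that state extensional. The inverse puts \<open>a\<close>
    back at \<open>Suc k\<close>.\<close>
  proof (rule sum.reindex_bij_witness[where j = "\<lambda>s. (s k, restrict s {0..k})"
        and i = "\<lambda>(y, s). s(Suc k := a)"], goal_cases)
    case (1 s)
    then show ?case by (auto simp: PiE_iff extensional_def fun_eq_iff le_Suc_eq)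
  next
    case (2 s)
    then show ?case by (auto simp: PiE_iff)
  next
    case (3 p)
    then show ?case by (auto simp: PiE_iff extensional_def fun_eq_iff)
  next
    case (4 p)
    then show ?case using Suc.prems by (auto simp: PiE_iff extensional_def)
  next
    case (5 s)
    then show ?case by (auto simp: mult.commute intro!: prod.cong arg_cong2[where f = times])
  qed
  also have "\<dots> = (\<Sum>y\<in>X. w (Suc k) a y * path_weight w X k y c)"
    by (subst sum.Sigma[symmetric])
       (use fin assms(1) in \<open>auto intro!: sum.cong simp: Suc.IH[symmetric] sum_distrib_left\<close>)
  finally show ?case by simp
qed

lemma beta_R_col_eq_path_weight:
  assumes "a \<in> Sigma_h_col \<gamma> r"
  shows "beta_R_col \<gamma> r z t a b c d =
    path_weight (\<lambda>i x y. mono_R z t (\<gamma> i) x (count b (\<gamma> i)) y (count d (\<gamma> i)))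
      (Sigma_h_col \<gamma> r) r a c"
  unfolding beta_R_col_def row_states_def
  using sum_paths_eq_path_weight[OF finite_Sigma_h_col assms,
      of "\<lambda>i x y. mono_R z t (\<gamma> i) x (count b (\<gamma> i)) y (count d (\<gamma> i))" r c]
  by simp

section \<open>The at most two nonzero outputs of a vertex with given left and top spins\<close>

lemma sum_two_points:
  assumes "finite A" "\<And>x. x \<in> A \<Longrightarrow> x \<noteq> p \<Longrightarrow> x \<noteq> q \<Longrightarrow> f x = 0" "p \<noteq> q"
  shows "sum f A = (if p \<in> A then f p else 0) + (if q \<in> A then f q else (0::'a::comm_monoid_add))"
proof -
  have "sum f A = sum f (A \<inter> {p, q})"
    by (rule sum.mono_neutral_right) (use assms in auto)
  also have "\<dots> = (if p \<in> A then f p else 0) + (if q \<in> A then f q else 0)"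
    using assms(3) by (auto simp: Int_insert_right)
  finally show ?thesis .
qed

lemma sum_mono_R_CPlus:
  fixes z t :: "'a::field"
  assumes "finite X" "CPlus \<in> X" "Color g \<in> X"
  shows "(\<Sum>(y, m)\<in>X \<times> {..D}. mono_R z t g CPlus n y m * F y m) =
    (if n \<le> D then F CPlus n else 0) +
    (if 1 \<le> n \<and> n - 1 \<le> D then (1 - t ^ n) / (1 - t) * F (Color g) (n - 1) else 0)"
proof -
  \<comment> \<open>For \<open>n = 0\<close> truncated subtraction turns the second point into
    \<open>(Color g, 0)\<close>, which has weight 0, in agreement with the guard
    \<open>1 \<le> n\<close>.\<close>
  have "(case x of (y, m) \<Rightarrow> mono_R z t g CPlus n y m * F y m) = 0"
    if "x \<noteq> (CPlus, n)" "x \<noteq> (Color g, n - 1)" for x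
    using that by (cases x; cases "fst x") auto
  from sum_two_points[OF _ this, of "X \<times> {..D}"] show ?thesis
    using assms by auto
qed

lemma sum_mono_R_same_color:
  fixes z t :: "'a::field"
  assumes "finite X" "CPlus \<in> X" "Color g \<in> X"
  shows "(\<Sum>(y, m)\<in>X \<times> {..D}. mono_R z t g (Color g) n y m * F y m) =
    (if n \<le> D then z * F (Color g) n else 0) +
    (if n + 1 \<le> D then z * (1 - t) * F CPlus (n + 1) else 0)"
proof -
  have "(case x of (y, m) \<Rightarrow> mono_R z t g (Color g) n y m * F y m) = 0"
    if "x \<noteq> (Color g, n)" "x \<noteq> (CPlus, n + 1)" for x
    using that by (cases x; cases "fst x") auto
  from sum_two_points[OF _ this, of "X \<times> {..D}"] show ?thesis
    using assms by auto
qed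

lemma sum_mono_R_other_color:
  fixes z t :: "'a::field"
  assumes "finite X" "Color h \<in> X" "h \<noteq> g"
  shows "(\<Sum>(y, m)\<in>X \<times> {..D}. mono_R z t g (Color h) n y m * F y m) =
    (if n \<le> D then (if g < h then 1 else t ^ n) * F (Color h) n else 0)"
proof -
  \<comment> \<open>The point \<open>(CPlus, n)\<close> is a dummy of weight 0, since only the color
    \<open>g\<close> can be absorbed; it lets \<open>sum_two_points\<close> apply again.\<close>
  have "(case x of (y, m) \<Rightarrow> mono_R z t g (Color h) n y m * F y m) = 0"
    if "x \<noteq> (Color h, n)" "x \<noteq> (CPlus, n)" for x
    using that assms by (cases x; cases "fst x") auto
  from sum_two_points[OF _ this, of "X \<times> {..D}"] show ?thesis
    using assms by auto
qed

section \<open>Lift sums over the rightmost columns and their recursion\<close>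

definition lift_sum :: "(nat \<Rightarrow> 'c::linorder) \<Rightarrow> nat \<Rightarrow> 'a::field \<Rightarrow> 'a \<Rightarrow> 'c multiset \<Rightarrow>
    nat \<Rightarrow> 'c hspin_col \<Rightarrow> hspin_unc \<Rightarrow> nat \<Rightarrow> 'a" where
  "lift_sum \<gamma> r z t b k x C D =
    (\<Sum>(c, d)\<in>{c \<in> Sigma_h_col \<gamma> r. p_h c = C} \<times> {d \<in> Sigma_v_col \<gamma> k. p_v d = D}.
      path_weight (\<lambda>i x y. mono_R z t (\<gamma> i) x (count b (\<gamma> i)) y (count d (\<gamma> i)))
        (Sigma_h_col \<gamma> r) k x c)"

lemma lift_sum_0:
  assumes "x \<in> Sigma_h_col \<gamma> r"
  shows "lift_sum \<gamma> r z t b 0 x C D = (if p_h x = C \<and> D = 0 then 1 else 0)"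
proof -
  have "{d \<in> Sigma_v_col \<gamma> 0. p_v d = D} = (if D = 0 then {{#}} else {})"
    by (auto simp: Sigma_v_col_def p_v_def)
  then show ?thesis
    using assms finite_Sigma_h_col[of \<gamma> r]
    by (auto simp: lift_sum_def sum.cartesian_product[symmetric])
qed

lemma finite_Sigma_v_col_size: "finite {d \<in> Sigma_v_col \<gamma> k. p_v d = D}"
proof -
  have "{d \<in> Sigma_v_col \<gamma> k. p_v d = D} \<subseteq>
      snd ` {(c, d). c \<in> Sigma_h_col \<gamma> k \<and> d \<in> Sigma_v_col \<gamma> k \<and> p_h c = UPlus \<and> p_v d = D}"
    by (force simp: Sigma_h_col_def)
  then show ?thesis
    by (rule finite_subset) (rule finite_imageI[OF finite_lifts])
qed

text \<open>By injectivity the color \<open>\<gamma> (Suc k)\<close> is absent from the multisets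
  over the first \<open>k\<close> colors, so splitting off its \<open>m\<close> copies is a
  bijection.\<close>

lemma sum_Sigma_v_col_Suc:
  assumes "inj_on \<gamma> {1..Suc k}"
  shows "(\<Sum>d\<in>{d \<in> Sigma_v_col \<gamma> (Suc k). p_v d = D}. f d) =
    (\<Sum>m\<le>D. \<Sum>d\<in>{d \<in> Sigma_v_col \<gamma> k. p_v d = D - m}. f (replicate_mset m (\<gamma> (Suc k)) + d))"
proof -
  let ?g = "\<gamma> (Suc k)"
  have img: "\<gamma> ` {1..Suc k} = insert ?g (\<gamma> ` {1..k})" by (auto simp: atLeastAtMostSuc_conv)
  have new: "?g \<notin> \<gamma> ` {1..k}"
    using assms by (auto dest: inj_onD)
  have "(\<Sum>d\<in>{d \<in> Sigma_v_col \<gamma> (Suc k). p_v d = D}. f d) =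
     (\<Sum>(m, d)\<in>Sigma {..D} (\<lambda>m. {d \<in> Sigma_v_col \<gamma> k. p_v d = D - m}). f (replicate_mset m ?g + d))"
  proof (rule sum.reindex_bij_witness[where j = "\<lambda>d. (count d ?g, filter_mset (\<lambda>c. c \<noteq> ?g) d)"
        and i = "\<lambda>(m, d). replicate_mset m ?g + d"], goal_cases)
    case (1 d)
    show ?case by (auto intro!: multiset_eqI)
  next
    case (2 d)
    have "size d = count d ?g + size (filter_mset (\<lambda>c. c \<noteq> ?g) d)"
      by (induction d) auto
    with 2 show ?case unfolding Sigma_v_col_def img p_v_def by auto
  next
    case (3 p)
    then have "?g \<notin># snd p" using new by (auto simp: Sigma_v_col_def)
    then show ?case by (cases p) (auto intro!: multiset_eqI simp: not_in_iff)
  next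
    case (4 p)
    then show ?case unfolding Sigma_v_col_def img p_v_def
      by (cases p) (auto simp: in_replicate_mset subset_iff)
  next
    case (5 d)
    have "replicate_mset (count d ?g) ?g + filter_mset (\<lambda>c. c \<noteq> ?g) d = d"
      by (auto intro!: multiset_eqI)
    then show ?case by simp
  qed
  then show ?thesis by (simp add: sum.Sigma finite_Sigma_v_col_size)
qed

text \<open>The leftmost column reads only the copies of its own color in \<open>d\<close>, and the
  other columns never see them. Its weight therefore factors out of the sum over the remaining
  lifts, and the rest is exchange of finite sums.\<close>

lemma lift_sum_Suc:
  assumes inj: "inj_on \<gamma> {1..Suc k}"
  shows "lift_sum \<gamma> r z t b (Suc k) x C D =
    (\<Sum>(y, m)\<in>Sigma_h_col \<gamma> r \<times> {..D}.
       mono_R z t (\<gamma> (Suc k)) x (count b (\<gamma> (Suc k))) y m * lift_sum \<gamma> r z t b k y C (D - m))"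
proof -
  let ?g = "\<gamma> (Suc k)" and ?X = "Sigma_h_col \<gamma> r"
  let ?C = "{c \<in> ?X. p_h c = C}" and ?V = "\<lambda>m. {d \<in> Sigma_v_col \<gamma> k. p_v d = D - m}"
  let ?w = "\<lambda>d i x y. mono_R z t (\<gamma> i) x (count b (\<gamma> i)) y (count d (\<gamma> i))"
  have new: "\<gamma> i \<noteq> ?g" if "1 \<le> i" "i \<le> k" for i
    using inj_onD[OF inj, of i "Suc k"] that by auto
  have split: "path_weight (?w (replicate_mset m ?g + d)) ?X (Suc k) x c =
      (\<Sum>y\<in>?X. mono_R z t ?g x (count b ?g) y m * path_weight (?w d) ?X k y c)"
    if "d \<in> ?V m" for m c d
  proof -
    have "count d ?g = 0"
      using that new by (auto simp: Sigma_v_col_def count_eq_zero_iff) fastforce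
    moreover have "path_weight (?w (replicate_mset m ?g + d)) ?X k y c = path_weight (?w d) ?X k y c"
      for y by (rule path_weight_cong) (simp add: new)
    ultimately show ?thesis by simp
  qed
  have "lift_sum \<gamma> r z t b (Suc k) x C D =
      (\<Sum>c\<in>?C. \<Sum>m\<le>D. \<Sum>d\<in>?V m. \<Sum>y\<in>?X.
         mono_R z t ?g x (count b ?g) y m * path_weight (?w d) ?X k y c)"
    unfolding lift_sum_def sum.cartesian_product[symmetric] sum_Sigma_v_col_Suc[OF inj]
    by (intro sum.cong refl) (rule split)
  also have "\<dots> = (\<Sum>c\<in>?C. \<Sum>m\<le>D. \<Sum>y\<in>?X. \<Sum>d\<in>?V m.
         mono_R z t ?g x (count b ?g) y m * path_weight (?w d) ?X k y c)"
    by (rule sum.cong[OF refl], rule sum.cong[OF refl], rule sum.swap)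
  also have "\<dots> = (\<Sum>m\<le>D. \<Sum>c\<in>?C. \<Sum>y\<in>?X. \<Sum>d\<in>?V m.
         mono_R z t ?g x (count b ?g) y m * path_weight (?w d) ?X k y c)"
    by (rule sum.swap)
  also have "\<dots> = (\<Sum>m\<le>D. \<Sum>y\<in>?X. \<Sum>c\<in>?C. \<Sum>d\<in>?V m.
         mono_R z t ?g x (count b ?g) y m * path_weight (?w d) ?X k y c)"
    by (rule sum.cong[OF refl], rule sum.swap)
  also have "\<dots> = (\<Sum>y\<in>?X. \<Sum>m\<le>D.
      mono_R z t ?g x (count b ?g) y m * lift_sum \<gamma> r z t b k y C (D - m))"
    by (subst sum.swap) (simp add: lift_sum_def sum.cartesian_product[symmetric] sum_distrib_left)
  finally show ?thesis by (simp add: sum.cartesian_product)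
qed

section \<open>Closed form of the lift sums, by induction on the number of columns\<close>

lemma geometric_quotient_add:
  fixes t :: "'a::field"
  shows "(1 - t ^ m) / (1 - t) * t ^ s + (1 - t ^ s) / (1 - t) = (1 - t ^ (m + s)) / (1 - t)"
  by (simp add: add_divide_distrib[symmetric] power_add algebra_simps)

lemma inj_on_of_strict_antimono_on:
  fixes f :: "'x::linorder \<Rightarrow> 'y::order"
  assumes "strict_antimono_on A f"
  shows "inj_on f A"
  using assms by (simp add: strict_antimono_iff_antimono)

text \<open>Left spins range over all \<open>r\<close> colors even when \<open>k < r\<close>,
  because column \<open>Suc k\<close> can send its own color into the \<open>k\<close> columns to
  its right. There it is smaller than every column color, so each column contributes
  \<open>t\<close> to the power of its top spin.\<close>

lemma lift_sum_eq:
  fixes \<gamma> :: "nat \<Rightarrow> 'c::linorder" and z t :: "'a::field"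
  assumes anti: "strict_antimono_on {1..r} \<gamma>" and "k \<le> r" and "x \<in> Sigma_h_col \<gamma> r"
  shows "lift_sum \<gamma> r z t b k x C D =
    (let S = \<Sum>i=1..k. count b (\<gamma> i) in
     if x \<in> Sigma_h_col \<gamma> k then beta_R_unc z t (p_h x) S C D
     else if C = UMinus \<and> D = S then t ^ S else 0)"
  using assms(2,3)
proof (induction k arbitrary: x D)
  case 0
  \<comment> \<open>With no columns \<open>S = 0\<close>: the spin \<open>+\<close> falls under the
    first branch, and every color under the second with \<open>t ^ 0 = 1\<close>.\<close>
  then show ?case
    by (cases C) (auto simp: lift_sum_0 Sigma_h_col_def)
next
  case (Suc k)
  let ?g = "\<gamma> (Suc k)" and ?X = "Sigma_h_col \<gamma> r"
  define n where "n = count b ?g"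
  define S where "S = (\<Sum>i=1..k. count b (\<gamma> i))"
  have less: "\<gamma> j < \<gamma> i" if "1 \<le> i" "i < j" "j \<le> r" for i j
    using anti that by (auto simp: monotone_on_def)
  have inj: "inj_on \<gamma> {1..Suc k}"
    using inj_on_of_strict_antimono_on[OF anti] by (rule inj_on_subset) (use Suc.prems(1) in auto)
  have X: "CPlus \<in> ?X" "Color ?g \<in> ?X"
    using Suc.prems by (auto simp: Sigma_h_col_def)
  have Xk: "Sigma_h_col \<gamma> (Suc k) = insert (Color ?g) (Sigma_h_col \<gamma> k)"
    by (auto simp: Sigma_h_col_def atLeastAtMostSuc_conv)
  have plus: "CPlus \<in> Sigma_h_col \<gamma> k" by (simp add: Sigma_h_col_def)
  have new: "Color ?g \<notin> Sigma_h_col \<gamma> k"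
    using inj by (auto simp: Sigma_h_col_def dest: inj_onD)
  have IH: "lift_sum \<gamma> r z t b k y C E =
     (if y \<in> Sigma_h_col \<gamma> k then beta_R_unc z t (p_h y) S C E
      else if C = UMinus \<and> E = S then t ^ S else 0)" if "y \<in> ?X" for y E
    using Suc.IH[OF _ that] Suc.prems(1) by (simp add: S_def Let_def)
  have rec: "lift_sum \<gamma> r z t b (Suc k) x C D =
    (\<Sum>(y, m)\<in>?X \<times> {..D}. mono_R z t ?g x n y m * lift_sum \<gamma> r z t b k y C (D - m))"
    unfolding n_def by (rule lift_sum_Suc[OF inj])
  have total: "(\<Sum>i=1..Suc k. count b (\<gamma> i)) = S + n" by (simp add: S_def n_def)
  consider "x = CPlus" | "x = Color ?g" | h where "x = Color h" "h \<noteq> ?g"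
    by (cases x) auto
  then show ?case
  proof cases
    case 1
    show ?thesis
    proof (cases C)
      case UPlus
      then show ?thesis
        using IH[OF X(1)] IH[OF X(2)] plus new
        unfolding 1 rec[unfolded 1 sum_mono_R_CPlus[OF finite_Sigma_h_col X]] total
        by (auto simp: Xk)
    next
      case UMinus
      define q where "q m = (1 - t ^ m) / (1 - t)" for m
      have unc: "beta_R_unc z t UPlus i UMinus j = (if i = j + 1 then q i else 0)" for i j
        by (simp add: q_def)
      \<comment> \<open>The outgoing color is emitted either further right (\<open>q S\<close>) or
        by the new column, after which it crosses the others (\<open>q n * t ^ S\<close>). The value
        \<open>q 0 = 0\<close> covers empty columns, where the guards remove a term.\<close>
      have q: "q 0 = 0" "q S + q n * t ^ S = q (S + n)"
        using geometric_quotient_add[of t n S] by (simp_all add: q_def add.commute)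
      show ?thesis
        using IH[OF X(1)] IH[OF X(2)] plus new q
        unfolding 1 rec[unfolded 1 sum_mono_R_CPlus[OF finite_Sigma_h_col X]] total
        unfolding UMinus q_def[symmetric] p_h.simps
        by (cases S; cases n) (auto simp: Xk unc simp del: beta_R_unc.simps)
    qed
  next
    case 2
    show ?thesis
      unfolding 2 rec[unfolded 2 sum_mono_R_same_color[OF finite_Sigma_h_col X]] total
      using IH[OF X(1)] IH[OF X(2)] plus new
      \<comment> \<open>For outgoing \<open>-\<close> the color passes with weight
        \<open>z * t ^ S\<close>, or is absorbed and a color is emitted later, with total
        \<open>z * (1 - t ^ S)\<close>; the sum is \<open>z\<close>. At \<open>t = 1\<close> the
        second contribution is 0 and the first is already \<open>z\<close>.\<close>
      by (cases C; cases "t = 1"; cases S) (auto simp: Xk divide_simps power_add algebra_simps)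
  next
    case 3
    \<comment> \<open>The color \<open>h\<close> passes through unchanged. As
      \<open>\<gamma>\<close> decreases, an \<open>h\<close> among the first \<open>k\<close> colors
      exceeds \<open>?g\<close> and gets weight 1; otherwise its index is above \<open>Suc k\<close>
      and it gains \<open>t ^ n\<close>, turning \<open>t ^ S\<close> into
      \<open>t ^ (S + n)\<close>.\<close>
    have "?g < h" if "Color h \<in> Sigma_h_col \<gamma> k"
      using that less Suc.prems(1) by (auto simp: Sigma_h_col_def)
    moreover have "\<not> ?g < h" if "Color h \<notin> Sigma_h_col \<gamma> k"
    proof -
      obtain j where j: "h = \<gamma> j" "1 \<le> j" "j \<le> r"
        using Suc.prems 3 by (auto simp: Sigma_h_col_def)
      have "\<not> j \<le> k" using that j by (auto simp: Sigma_h_col_def)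
      moreover have "j \<noteq> Suc k" using 3 j by auto
      ultimately have "Suc k < j" by simp
      then show ?thesis using less[of "Suc k" j] j by auto
    qed
    moreover have "Color h \<in> ?X" using Suc.prems 3 by simp
    ultimately show ?thesis
      unfolding 3(1) rec[unfolded 3(1)] total
      using 3 IH[of "Color h"]
      by (cases C; cases "Color h \<in> Sigma_h_col \<gamma> k")
         (auto simp: sum_mono_R_other_color finite_Sigma_h_col Xk Let_def power_add[symmetric])
  qed
qed

theorem proposition5p1:
  fixes \<gamma> :: "nat \<Rightarrow> 'c::linorder" and r :: nat and z t :: "'a::field"
    and A C :: hspin_unc and B D :: nat
    and a :: "'c hspin_col" and b :: "'c multiset"
  assumes "r \<ge> 1" and "strict_antimono_on {1..r} \<gamma>"
    and "a \<in> Sigma_h_col \<gamma> r" and "b \<in> Sigma_v_col \<gamma> r"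
    and "p_h a = A" and "p_v b = B"
  shows "beta_R_unc z t A B C D =
    (\<Sum>(c, d)\<in>{(c, d). c \<in> Sigma_h_col \<gamma> r \<and> d \<in> Sigma_v_col \<gamma> r \<and> p_h c = C \<and> p_v d = D}.
       beta_R_col \<gamma> r z t a b c d)"
proof -
  have "B = (\<Sum>g\<in>\<gamma> ` {1..r}. count b g)"
    using assms(4,6) unfolding Sigma_v_col_def p_v_def size_multiset_overloaded_eq
    by (auto intro!: sum.mono_neutral_left simp: not_in_iff)
  also have "\<dots> = (\<Sum>i=1..r. count b (\<gamma> i))"
    by (rule sum.reindex[OF inj_on_of_strict_antimono_on[OF assms(2)], unfolded o_def])
  \<comment> \<open>At \<open>k = r\<close> every admissible left spin lies in
    \<open>Sigma_h_col \<gamma> k\<close>, so only the uncolored weight remains.\<close>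
  finally have "beta_R_unc z t A B C D = lift_sum \<gamma> r z t b r a C D"
    using lift_sum_eq[OF assms(2) order_refl assms(3), of z t b C D] assms(3,5) by simp
  also have "\<dots> = (\<Sum>(c, d)\<in>{(c, d). c \<in> Sigma_h_col \<gamma> r \<and> d \<in> Sigma_v_col \<gamma> r \<and> p_h c = C \<and> p_v d = D}.
       beta_R_col \<gamma> r z t a b c d)"
    unfolding lift_sum_def beta_R_col_eq_path_weight[OF assms(3)]
    by (rule sum.cong) auto
  finally show ?thesis .
qed

end
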